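(* Let $X$ and $Y$ be 1-step irreducible shifts of finite type and $Z$ a sofic shift, with 1-block factor codes $\phi:X\to Y$, $\psi:Y\to Z$ and $\pi=\psi\circ\phi$. Then for all $x\in X$ we have $$[x]_\phi\subset[x]_{\phi/\psi}=[x]_\pi .$$ Moreover, any two points in a single $\pi$-class are sent by $\phi$ into the same $\psi$-class, and for every $x\in X$ the set $[x]_{\phi/\psi}$ is the disjoint union of the distinct $\phi$-classes among the sets $[x']_\phi$ with $x'\sim_{\phi/\psi}x$.
   Context: A shift space over a finite alphabet $\mathcal{A}$ is a closed shift-invariant subset of $\mathcal{A}^{\mathbb{Z}}$ (two-sided). A factor code is a surjective, continuous, shift-commuting map between shift spaces; it is 1-block if $x|_0$ determines the $0$-th coordinate of the image of $x$. The coordinates of a point $x$ on a set $I\subset\mathbb{Z}$ are written $x|_I$. A shift of finite type $X$ is 1-step if for every symbol $a$, whenever $ua$ and $av$ are blocks occurring in points of $X$, so is $uav$. A sofic shift is the image of a shift of finite type under a factor code. **Transition classes.** Let $\pi:X\to Y$ be a factor code. Given $m\in\mathbb{Z}$ and $x,x'\in X$ with $\pi(x)=\pi(x')$, a $(\pi,m)$-bridge from $x$ to $x'$ is a point $\vec{x}\in X$ such that, for some $n>m$, $\vec{x}|_{(-\infty,m]}=x|_{(-\infty,m]}$, $\vec{x}|_{[n,\infty)}=x'|_{[n,\infty)}$ and $\pi(\vec{x})=\pi(x)=\pi(x')$. Write $x\to_\pi x'$ if for every $m\in\mathbb{Z}$ there is a $(\pi,m)$-bridge from $x$ to $x'$,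 and $x\sim_\pi x'$ if $x\to_\pi x'$ and $x'\to_\pi x$. This is an equivalence relation; the class of $x$ is denoted $[x]_\pi$ and called a $\pi$-class. The same definitions apply to $\phi:X\to Y$ and $\psi:Y\to Z$, giving $\phi$-classes $[x]_\phi\subset X$ and $\psi$-classes $[y]_\psi\subset Y$. **Relative transition classes.** Let $\phi:X\to Y$ and $\psi:Y\to Z$ be factor codes. Given $m\in\mathbb{Z}$ and $x,x'\in X$ with $\phi(x)\sim_\psi\phi(x')$, a $(\phi/\psi,m)$-bridge from $x$ to $x'$ is a point $\vec{x}\in X$ such that, for some $n>m$, $\vec{x}|_{(-\infty,m]}=x|_{(-\infty,m]}$, $\vec{x}|_{[n,\infty)}=x'|_{[n,\infty)}$ and $\phi(x)\sim_\psi\phi(x')\sim_\psi\phi(\vec{x})$. Write $x\to_{\phi/\psi}x'$ if for every $m\in\mathbb{Z}$ there is a $(\phi/\psi,m)$-bridge from $x$ to $x'$, and $x\sim_{\phi/\psi}x'$ if $x\to_{\phi/\psi}x'$ and $x'\to_{\phi/\psi}x$. The set of all $x'$ with $x'\sim_{\phi/\psi}x$ is denoted $[x]_{\phi/\psi}$. *)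

theory Defs
  imports "HOL-Analysis.Analysis"
begin

section \<open>Shift spaces\<close>

definition shift :: "(int \<Rightarrow> 'a) \<Rightarrow> (int \<Rightarrow> 'a)" where
  "shift x = (\<lambda>i. x (i + 1))"

text \<open>The product of discrete topologies. For a finite alphabet \<open>A\<close> it induces on \<open>A\<^sup>\<int>\<close> the
  usual compact product topology, and \<open>A\<^sup>\<int>\<close> is closed in it, so that closedness of a shift
  space does not depend on the alphabet named.\<close>

definition seq_topology :: "(int \<Rightarrow> 'a) topology" where
  "seq_topology = product_topology (\<lambda>_. discrete_topology UNIV) UNIV"

definition shift_space :: "(int \<Rightarrow> 'a) set \<Rightarrow> bool" where
  "shift_space X \<longleftrightarrow>
     (\<exists>A. finite A \<and> (\<forall>x\<in>X. range x \<subseteq> A)) \<and> closedin seq_topology X \<and> shift ` X = X"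

definition occurs_in :: "'a list \<Rightarrow> (int \<Rightarrow> 'a) \<Rightarrow> bool" where
  "occurs_in w x \<longleftrightarrow> (\<exists>i. \<forall>k<length w. x (i + int k) = w ! k)"

definition blocks :: "(int \<Rightarrow> 'a) set \<Rightarrow> 'a list set" where
  "blocks X = {w. \<exists>x\<in>X. occurs_in w x}"

definition shift_of_finite_type :: "(int \<Rightarrow> 'a) set \<Rightarrow> bool" where
  "shift_of_finite_type X \<longleftrightarrow>
     (\<exists>A F. finite A \<and> finite F \<and> X = {x. range x \<subseteq> A \<and> (\<forall>w\<in>F. \<not> occurs_in w x)})"

definition one_step :: "(int \<Rightarrow> 'a) set \<Rightarrow> bool" where
  "one_step X \<longleftrightarrow>
     (\<forall>a u v. u @ [a] \<in> blocks X \<longrightarrow> a # v \<in> blocks X \<longrightarrow> u @ [a] @ v \<in> blocks X)"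

definition irreducible_shift :: "(int \<Rightarrow> 'a) set \<Rightarrow> bool" where
  "irreducible_shift X \<longleftrightarrow> (\<forall>u\<in>blocks X. \<forall>v\<in>blocks X. \<exists>w. u @ w @ v \<in> blocks X)"


section \<open>Factor codes\<close>

definition factor_code ::
  "(int \<Rightarrow> 'a) set \<Rightarrow> (int \<Rightarrow> 'b) set \<Rightarrow> ((int \<Rightarrow> 'a) \<Rightarrow> (int \<Rightarrow> 'b)) \<Rightarrow> bool" where
  "factor_code X Y f \<longleftrightarrow>
     shift_space X \<and> shift_space Y \<and>
     continuous_map (subtopology seq_topology X) (subtopology seq_topology Y) f \<and>
     f ` X = Y \<and> (\<forall>x\<in>X. f (shift x) = shift (f x))"

definition one_block :: "(int \<Rightarrow> 'a) set \<Rightarrow> ((int \<Rightarrow> 'a) \<Rightarrow> (int \<Rightarrow> 'b)) \<Rightarrow> bool" where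
  "one_block X f \<longleftrightarrow> (\<forall>x\<in>X. \<forall>x'\<in>X. x 0 = x' 0 \<longrightarrow> f x 0 = f x' 0)"

text \<open>A type cannot be quantified existentially, so the covering shift of finite type is taken
  over a finite subset of \<open>nat\<close>; any finite alphabet can be renamed into one.\<close>

definition sofic :: "(int \<Rightarrow> 'a) set \<Rightarrow> bool" where
  "sofic Z \<longleftrightarrow>
     (\<exists>(W :: (int \<Rightarrow> nat) set) f. shift_of_finite_type W \<and> factor_code W Z f)"


section \<open>Transition classes\<close>

definition bridge ::
  "(int \<Rightarrow> 'a) set \<Rightarrow> ((int \<Rightarrow> 'a) \<Rightarrow> (int \<Rightarrow> 'b)) \<Rightarrow> int
     \<Rightarrow> (int \<Rightarrow> 'a) \<Rightarrow> (int \<Rightarrow> 'a) \<Rightarrow> (int \<Rightarrow> 'a) \<Rightarrow> bool" where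
  "bridge X f m x x' b \<longleftrightarrow>
     b \<in> X \<and> (\<exists>n>m. (\<forall>i\<le>m. b i = x i) \<and> (\<forall>i\<ge>n. b i = x' i)) \<and> f b = f x \<and> f x = f x'"

definition reaches ::
  "(int \<Rightarrow> 'a) set \<Rightarrow> ((int \<Rightarrow> 'a) \<Rightarrow> (int \<Rightarrow> 'b)) \<Rightarrow> (int \<Rightarrow> 'a) \<Rightarrow> (int \<Rightarrow> 'a) \<Rightarrow> bool" where
  "reaches X f x x' \<longleftrightarrow> x \<in> X \<and> x' \<in> X \<and> f x = f x' \<and> (\<forall>m. \<exists>b. bridge X f m x x' b)"

definition trans_equiv ::
  "(int \<Rightarrow> 'a) set \<Rightarrow> ((int \<Rightarrow> 'a) \<Rightarrow> (int \<Rightarrow> 'b)) \<Rightarrow> (int \<Rightarrow> 'a) \<Rightarrow> (int \<Rightarrow> 'a) \<Rightarrow> bool" where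
  "trans_equiv X f x x' \<longleftrightarrow> reaches X f x x' \<and> reaches X f x' x"

definition trans_class ::
  "(int \<Rightarrow> 'a) set \<Rightarrow> ((int \<Rightarrow> 'a) \<Rightarrow> (int \<Rightarrow> 'b)) \<Rightarrow> (int \<Rightarrow> 'a) \<Rightarrow> (int \<Rightarrow> 'a) set" where
  "trans_class X f x = {x'. trans_equiv X f x' x}"

definition trans_classes ::
  "(int \<Rightarrow> 'a) set \<Rightarrow> ((int \<Rightarrow> 'a) \<Rightarrow> (int \<Rightarrow> 'b)) \<Rightarrow> (int \<Rightarrow> 'a) set set" where
  "trans_classes X f = trans_class X f ` X"


section \<open>Relative transition classes\<close>

definition rel_bridge ::
  "(int \<Rightarrow> 'a) set \<Rightarrow> (int \<Rightarrow> 'b) set \<Rightarrow> ((int \<Rightarrow> 'a) \<Rightarrow> (int \<Rightarrow> 'b))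
     \<Rightarrow> ((int \<Rightarrow> 'b) \<Rightarrow> (int \<Rightarrow> 'c)) \<Rightarrow> int
     \<Rightarrow> (int \<Rightarrow> 'a) \<Rightarrow> (int \<Rightarrow> 'a) \<Rightarrow> (int \<Rightarrow> 'a) \<Rightarrow> bool" where
  "rel_bridge X Y f g m x x' b \<longleftrightarrow>
     b \<in> X \<and> (\<exists>n>m. (\<forall>i\<le>m. b i = x i) \<and> (\<forall>i\<ge>n. b i = x' i)) \<and>
     trans_equiv Y g (f x) (f x') \<and> trans_equiv Y g (f x') (f b)"

definition rel_reaches ::
  "(int \<Rightarrow> 'a) set \<Rightarrow> (int \<Rightarrow> 'b) set \<Rightarrow> ((int \<Rightarrow> 'a) \<Rightarrow> (int \<Rightarrow> 'b))
     \<Rightarrow> ((int \<Rightarrow> 'b) \<Rightarrow> (int \<Rightarrow> 'c)) \<Rightarrow> (int \<Rightarrow> 'a) \<Rightarrow> (int \<Rightarrow> 'a) \<Rightarrow> bool" where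
  "rel_reaches X Y f g x x' \<longleftrightarrow>
     x \<in> X \<and> x' \<in> X \<and> trans_equiv Y g (f x) (f x') \<and>
     (\<forall>m. \<exists>b. rel_bridge X Y f g m x x' b)"

definition rel_equiv ::
  "(int \<Rightarrow> 'a) set \<Rightarrow> (int \<Rightarrow> 'b) set \<Rightarrow> ((int \<Rightarrow> 'a) \<Rightarrow> (int \<Rightarrow> 'b))
     \<Rightarrow> ((int \<Rightarrow> 'b) \<Rightarrow> (int \<Rightarrow> 'c)) \<Rightarrow> (int \<Rightarrow> 'a) \<Rightarrow> (int \<Rightarrow> 'a) \<Rightarrow> bool" where
  "rel_equiv X Y f g x x' \<longleftrightarrow> rel_reaches X Y f g x x' \<and> rel_reaches X Y f g x' x"

definition rel_class ::
  "(int \<Rightarrow> 'a) set \<Rightarrow> (int \<Rightarrow> 'b) set \<Rightarrow> ((int \<Rightarrow> 'a) \<Rightarrow> (int \<Rightarrow> 'b))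
     \<Rightarrow> ((int \<Rightarrow> 'b) \<Rightarrow> (int \<Rightarrow> 'c)) \<Rightarrow> (int \<Rightarrow> 'a) \<Rightarrow> (int \<Rightarrow> 'a) set" where
  "rel_class X Y f g x = {x'. rel_equiv X Y f g x' x}"

end

theory Submission
  imports Defs
begin

text \<open>Everything rests on two observations about how bridges interact with right asymptotics.

  If two points with the same image agree from some coordinate on, then each of them is itself a
  bridge to the other, whatever the starting coordinate, so they are equivalent
  (\<open>trans_equiv_if_right_asymptotic\<close>). Now let \<open>b\<close> be a \<open>\<pi>\<close>-bridge from \<open>x\<close> to \<open>x'\<close>. As \<open>\<phi>\<close> acts
  coordinate by coordinate, \<open>\<phi> b\<close> is a \<open>\<psi>\<close>-bridge from \<open>\<phi> x\<close> to \<open>\<phi> x'\<close>; hence \<open>\<phi>\<close> maps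
  \<open>\<pi>\<close>-equivalent points to \<open>\<psi>\<close>-equivalent points. Moreover \<open>\<phi> b\<close> agrees with \<open>\<phi> x'\<close> far to the
  right, so it lies in the \<open>\<psi>\<close>-class of \<open>\<phi> x'\<close> for free, and \<open>b\<close> is even a relative bridge.
  Conversely, \<open>\<psi>\<close>-equivalent points have equal images, so a relative bridge is a \<open>\<pi>\<close>-bridge. Thus
  the relative classes are exactly the \<open>\<pi>\<close>-classes. Since
  points with equal \<open>\<phi>\<close>-images have equal \<open>\<pi>\<close>-images, every \<open>\<phi>\<close>-bridge is a \<open>\<pi>\<close>-bridge, which puts
  each \<open>\<phi>\<close>-class inside a \<open>\<pi>\<close>-class.

  The decomposition into \<open>\<phi>\<close>-classes is then the statement that \<open>\<phi>\<close>- and \<open>\<pi>\<close>-equivalence are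
  equivalence relations, the first finer than the second. Only transitivity needs
  an argument: a bridge from \<open>x\<close> to \<open>x'\<close> and a later one from \<open>x'\<close> to \<open>x''\<close> share a symbol where both
  follow \<open>x'\<close>, and in a 1-step shift of finite type they can be cut and joined there
  (\<open>one_step_glue\<close>).\<close>


section \<open>One-block codes act coordinate by coordinate\<close>

definition coordinatewise ::
  "(int \<Rightarrow> 'a) set \<Rightarrow> ((int \<Rightarrow> 'a) \<Rightarrow> (int \<Rightarrow> 'b)) \<Rightarrow> bool" where
  "coordinatewise X f \<longleftrightarrow> (\<forall>x\<in>X. \<forall>x'\<in>X. \<forall>i. x i = x' i \<longrightarrow> f x i = f x' i)"

lemma coordinatewiseD:
  assumes "coordinatewise X f" "x \<in> X" "x' \<in> X" "x i = x' i"
  shows "f x i = f x' i"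
  using assms unfolding coordinatewise_def by blast

lemma coordinatewise_comp:
  assumes "coordinatewise X f" "coordinatewise Y g" "f ` X \<subseteq> Y"
  shows "coordinatewise X (g \<circ> f)"
  unfolding coordinatewise_def comp_apply
proof (intro ballI allI impI)
  fix x x' i assume x: "x \<in> X" "x' \<in> X" "x i = x' i"
  have "f x \<in> Y" "f x' \<in> Y" using assms(3) x by blast+
  then show "g (f x) i = g (f x') i"
    by (rule coordinatewiseD[OF assms(2)]) (rule coordinatewiseD[OF assms(1) x])
qed

text \<open>Commuting with \<open>shift\<close> extends to negative translations because \<open>shift\<close> maps \<open>X\<close> onto \<open>X\<close>.\<close>

lemma translate_in_shift_space:
  fixes X :: "(int \<Rightarrow> 'a) set"
  assumes X: "shift ` X = X" and comm: "\<forall>x\<in>X. f (shift x) = shift (f x)" and x: "x \<in> X"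
  shows "(\<lambda>j. x (j + i)) \<in> X \<and> f (\<lambda>j. x (j + i)) = (\<lambda>j. f x (j + i))"
proof (induction i rule: int_induct[where k = 0])
  case base
  show ?case using x by simp
next
  case (step1 i)
  let ?y = "\<lambda>j. x (j + i)"
  have eq: "(\<lambda>j. x (j + (i + 1))) = shift ?y"
    by (auto simp: shift_def algebra_simps)
  have "shift ?y \<in> X" using step1 X by blast
  moreover have "f (shift ?y) = (\<lambda>j. f x (j + (i + 1)))"
    using step1 comm by (auto simp: shift_def algebra_simps)
  ultimately show ?case unfolding eq by blast
next
  case (step2 i)
  obtain z where z: "z \<in> X" "(\<lambda>j. x (j + i)) = shift z"
    using step2 X by blast
  have eq: "(\<lambda>j. x (j + (i - 1))) = z"
  proof
    fix j show "x (j + (i - 1)) = z j"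
      using fun_cong[OF z(2), of "j - 1"] by (simp add: shift_def algebra_simps)
  qed
  have "shift (f z) = (\<lambda>j. f x (j + i))"
    using step2 z comm by auto
  then have "f z = (\<lambda>j. f x (j + (i - 1)))"
  proof (intro ext)
    fix j assume "shift (f z) = (\<lambda>j. f x (j + i))"
    from fun_cong[OF this, of "j - 1"] show "f z j = f x (j + (i - 1))"
      by (simp add: shift_def algebra_simps)
  qed
  then show ?case unfolding eq using z(1) by blast
qed

lemma coordinatewise_one_block_factor_code:
  assumes "factor_code X Y f" and "one_block X f"
  shows "coordinatewise X f"
  unfolding coordinatewise_def
proof (intro ballI allI impI)
  fix x x' i assume x: "x \<in> X" "x' \<in> X" and eq: "x i = x' i"
  have X: "shift ` X = X" and comm: "\<forall>x\<in>X. f (shift x) = shift (f x)"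
    using assms(1) unfolding factor_code_def shift_space_def by blast+
  let ?t = "\<lambda>x j. x (j + i)"
  have t: "?t z \<in> X" "f (?t z) 0 = f z i" if "z \<in> X" for z
    using translate_in_shift_space[OF X comm that, of i] by (blast, metis add_0)
  have "f (?t x) 0 = f (?t x') 0"
    using assms(2)[unfolded one_block_def, rule_format, OF t(1)[OF x(1)] t(1)[OF x(2)]] eq
    by simp
  then show "f x i = f x' i" unfolding t(2)[OF x(1)] t(2)[OF x(2)] .
qed


section \<open>Gluing points of a 1-step shift of finite type\<close>

lemma segment_in_blocks:
  assumes "x \<in> X"
  shows "map x [a..b] \<in> blocks X"
proof -
  have "\<forall>k<length (map x [a..b]). x (a + int k) = map x [a..b] ! k"
    by (auto simp: nth_upto)
  then show ?thesis using assms unfolding blocks_def occurs_in_def by blast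
qed

text \<open>A forbidden word in the glued point would lie in a finite window around the cut, and by the
  1-step property the content of that window occurs in an actual point of \<open>X\<close>.\<close>

lemma one_step_glue:
  assumes sft: "shift_of_finite_type X" and one: "one_step X"
    and x: "x \<in> X" and y: "y \<in> X" and eq: "x n = y n"
  shows "(\<lambda>i. if i \<le> n then x i else y i) \<in> X" (is "?g \<in> X")
proof -
  obtain A F where X: "X = {x. range x \<subseteq> A \<and> (\<forall>w\<in>F. \<not> occurs_in w x)}"
    using sft unfolding shift_of_finite_type_def by blast
  have "\<not> occurs_in w ?g" if w: "w \<in> F" for w
  proof
    assume "occurs_in w ?g"
    then obtain i where i: "\<And>k. k < length w \<Longrightarrow> ?g (i + int k) = w ! k"
      unfolding occurs_in_def by blast
    define a where "a = min i n"
    define b where "b = max (i + int (length w)) n"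
    have ab: "a \<le> n" "n \<le> b" "a \<le> i" "i + int (length w) \<le> b"
      unfolding a_def b_def by auto
    have left: "map x [a..n - 1] @ [x n] \<in> blocks X"
      using segment_in_blocks[OF x, of a n] ab(1) by (simp add: upto_rec2)
    have right: "x n # map y [n + 1..b] \<in> blocks X"
      using segment_in_blocks[OF y, of n b] ab(2) eq by (simp add: upto_rec1)
    have "map ?g [a..b] = map ?g [a..n - 1] @ [?g n] @ map ?g [n + 1..b]"
      using upto_split3[of a n b] ab by simp
    also have "\<dots> = map x [a..n - 1] @ [x n] @ map y [n + 1..b]"
      by auto
    finally have "map ?g [a..b] \<in> blocks X"
      using one left right unfolding one_step_def by metis
    then obtain z j where z: "z \<in> X"
      and zj: "\<And>k. k < length [a..b] \<Longrightarrow> z (j + int k) = map ?g [a..b] ! k"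
      unfolding blocks_def occurs_in_def by auto
    have "z (j + (i - a) + int k) = w ! k" if k: "k < length w" for k
    proof -
      define l where "l = nat (i - a) + k"
      have l: "int l = i - a + int k" using ab unfolding l_def by simp
      then have lb: "l < length [a..b]" using ab k by auto
      have "z (j + int l) = ?g (a + int l)"
        using zj[OF lb] lb l ab k by (simp add: nth_upto)
      moreover have "j + int l = j + (i - a) + int k" "a + int l = i + int k"
        using l by simp_all
      ultimately show ?thesis using i[OF k] by metis
    qed
    then have "occurs_in w z" unfolding occurs_in_def by blast
    then show False using z w X by blast
  qed
  moreover have "range ?g \<subseteq> A" using x y X by auto
  ultimately show ?thesis using X by blast
qed


section \<open>Transition equivalence\<close>

lemma trans_equiv_sym: "trans_equiv X f x x' \<Longrightarrow> trans_equiv X f x' x"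
  unfolding trans_equiv_def by blast

lemma trans_equiv_image_eq: "trans_equiv X f x x' \<Longrightarrow> f x = f x'"
  unfolding trans_equiv_def reaches_def by blast

lemma reachesE:
  assumes "reaches X f x x'"
  obtains b n where "b \<in> X" "n > m" "\<forall>i\<le>m. b i = x i" "\<forall>i\<ge>n. b i = x' i" "f b = f x"
  using assms unfolding reaches_def bridge_def by blast

text \<open>The first point serves as a bridge to the second for every \<open>m\<close>; the switch is simply declared
  to happen after both \<open>m\<close> and \<open>n\<close>.\<close>

lemma reaches_if_right_asymptotic:
  assumes "x \<in> X" "x' \<in> X" "f x = f x'" and "\<forall>i\<ge>n. x i = x' i"
  shows "reaches X f x x'"
proof -
  have "bridge X f m x x' x" for m
    using assms unfolding bridge_def by (auto intro!: exI[of _ "max n (m + 1)"])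
  then show ?thesis using assms unfolding reaches_def by blast
qed

lemma trans_equiv_if_right_asymptotic:
  assumes "x \<in> X" "x' \<in> X" "f x = f x'" and "\<forall>i\<ge>n. x i = x' i"
  shows "trans_equiv X f x x'"
  using assms reaches_if_right_asymptotic[of x X x' f n] reaches_if_right_asymptotic[of x' X x f n]
  unfolding trans_equiv_def by simp

lemma trans_equiv_refl: "x \<in> X \<Longrightarrow> trans_equiv X f x x"
  by (rule trans_equiv_if_right_asymptotic) auto

lemma reaches_trans:
  assumes sft: "shift_of_finite_type X" "one_step X" and cw: "coordinatewise X f"
    and r1: "reaches X f x x'" and r2: "reaches X f x' x''"
  shows "reaches X f x x''"
proof -
  have "\<exists>b. bridge X f m x x'' b" for m
  proof -
    obtain b n where b: "b \<in> X" "n > m" "\<forall>i\<le>m. b i = x i" "\<forall>i\<ge>n. b i = x' i" "f b = f x"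
      using reachesE[OF r1] by blast
    obtain c k where c: "c \<in> X" "k > n" "\<forall>i\<le>n. c i = x' i" "\<forall>i\<ge>k. c i = x'' i" "f c = f x'"
      using reachesE[OF r2] by blast
    define g where "g = (\<lambda>i. if i \<le> n then b i else c i)"
    have g: "g \<in> X"
      unfolding g_def using one_step_glue[OF sft b(1) c(1), of n] b(4) c(3) by simp
    have "f g i = f x i" for i
    proof (cases "i \<le> n")
      case True
      then show ?thesis using coordinatewiseD[OF cw g b(1), of i] b(5) by (simp add: g_def)
    next
      case False
      then show ?thesis using coordinatewiseD[OF cw g c(1), of i] c(5) r1
        by (simp add: g_def reaches_def)
    qed
    then have "bridge X f m x x'' g"
      unfolding bridge_def using g b c r1 r2
      by (auto simp: g_def reaches_def intro!: exI[of _ k])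
    then show ?thesis by blast
  qed
  then show ?thesis using r1 r2 unfolding reaches_def by simp
qed

lemma trans_equiv_trans:
  assumes "shift_of_finite_type X" "one_step X" "coordinatewise X f"
    and "trans_equiv X f x x'" "trans_equiv X f x' x''"
  shows "trans_equiv X f x x''"
  using assms reaches_trans unfolding trans_equiv_def by blast

lemma pairwise_disjnt_trans_classes:
  assumes "shift_of_finite_type X" "one_step X" "coordinatewise X f"
  shows "pairwise disjnt {trans_class X f x |x. P x}"
proof -
  have "trans_class X f x = trans_class X f x'"
    if "z \<in> trans_class X f x" "z \<in> trans_class X f x'" for x x' z
    using that trans_equiv_trans[OF assms] trans_equiv_sym[of X f]
    unfolding trans_class_def by blast
  then show ?thesis unfolding pairwise_def disjnt_def by blast
qed


section \<open>Relative transition equivalence\<close>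

text \<open>Applying \<open>f\<close> to a bridge for \<open>g \<circ> f\<close> preserves its agreement with the two end points, so the
  result is a bridge for \<open>g\<close>.\<close>

lemma reaches_comp_imp_reaches_image:
  assumes cw: "coordinatewise X f" and fX: "f ` X \<subseteq> Y" and r: "reaches X (g \<circ> f) x x'"
  shows "reaches Y g (f x) (f x')"
proof -
  have x: "x \<in> X" "x' \<in> X" "g (f x) = g (f x')" using r unfolding reaches_def comp_apply by blast+
  have "\<exists>c. bridge Y g m (f x) (f x') c" for m
  proof -
    obtain b n where b: "b \<in> X" "n > m" "\<forall>i\<le>m. b i = x i" "\<forall>i\<ge>n. b i = x' i" "g (f b) = g (f x)"
      using reachesE[OF r, unfolded comp_apply] by blast
    have "\<forall>i\<le>m. f b i = f x i" "\<forall>i\<ge>n. f b i = f x' i"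
      using b x coordinatewiseD[OF cw] by blast+
    then have "bridge Y g m (f x) (f x') (f b)"
      unfolding bridge_def using b x fX by blast
    then show ?thesis by blast
  qed
  then show ?thesis using x fX unfolding reaches_def by blast
qed

lemma trans_equiv_comp_imp_trans_equiv_image:
  assumes "coordinatewise X f" "f ` X \<subseteq> Y" "trans_equiv X (g \<circ> f) x x'"
  shows "trans_equiv Y g (f x) (f x')"
  using assms reaches_comp_imp_reaches_image unfolding trans_equiv_def by blast

text \<open>A bridge for \<open>g \<circ> f\<close> need not be altered to become a relative one: its image is right asymptotic
  to that of its target.\<close>

lemma rel_reaches_if_reaches_comp:
  assumes cw: "coordinatewise X f" and fX: "f ` X \<subseteq> Y"
    and r: "reaches X (g \<circ> f) x x'" and eqv: "trans_equiv Y g (f x) (f x')"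
  shows "rel_reaches X Y f g x x'"
proof -
  have x: "x \<in> X" "x' \<in> X" "g (f x) = g (f x')" using r unfolding reaches_def comp_apply by blast+
  have "\<exists>b. rel_bridge X Y f g m x x' b" for m
  proof -
    obtain b n where b: "b \<in> X" "n > m" "\<forall>i\<le>m. b i = x i" "\<forall>i\<ge>n. b i = x' i" "g (f b) = g (f x)"
      using reachesE[OF r, unfolded comp_apply] by blast
    have "\<forall>i\<ge>n. f x' i = f b i"
      using b x coordinatewiseD[OF cw x(2) b(1)] by simp
    then have "trans_equiv Y g (f x') (f b)"
      using trans_equiv_if_right_asymptotic[of "f x'" Y "f b" g n] x b fX
      by (simp add: image_subset_iff)
    then have "rel_bridge X Y f g m x x' b"
      unfolding rel_bridge_def using b eqv by blast
    then show ?thesis by blast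
  qed
  then show ?thesis using x eqv unfolding rel_reaches_def by blast
qed

lemma reaches_comp_if_rel_reaches:
  assumes "rel_reaches X Y f g x x'"
  shows "reaches X (g \<circ> f) x x'"
proof -
  have "bridge X (g \<circ> f) m x x' b" if "rel_bridge X Y f g m x x' b" for m b
    using that trans_equiv_image_eq[of Y g "f x" "f x'"] trans_equiv_image_eq[of Y g "f x'" "f b"]
    unfolding rel_bridge_def bridge_def by auto
  then show ?thesis
    using assms trans_equiv_image_eq[of Y g "f x" "f x'"]
    unfolding rel_reaches_def reaches_def by (auto, blast)
qed

lemma rel_equiv_iff_trans_equiv_comp:
  assumes "coordinatewise X f" and "f ` X \<subseteq> Y"
  shows "rel_equiv X Y f g x x' \<longleftrightarrow> trans_equiv X (g \<circ> f) x x'"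
proof
  assume "rel_equiv X Y f g x x'"
  then show "trans_equiv X (g \<circ> f) x x'"
    unfolding rel_equiv_def trans_equiv_def using reaches_comp_if_rel_reaches by blast
next
  assume eqv: "trans_equiv X (g \<circ> f) x x'"
  then have Y: "trans_equiv Y g (f x) (f x')"
    by (rule trans_equiv_comp_imp_trans_equiv_image[OF assms])
  have "reaches X (g \<circ> f) x x'" "reaches X (g \<circ> f) x' x"
    using eqv unfolding trans_equiv_def by simp_all
  then show "rel_equiv X Y f g x x'"
    unfolding rel_equiv_def
    using rel_reaches_if_reaches_comp[OF assms _ Y]
      rel_reaches_if_reaches_comp[OF assms _ trans_equiv_sym[OF Y]] by simp
qed

lemma reaches_imp_reaches_comp:
  assumes "reaches X f x x'"
  shows "reaches X (g \<circ> f) x x'"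
proof -
  have "bridge X (g \<circ> f) m x x' b" if "bridge X f m x x' b" for m b
    using that unfolding bridge_def by simp
  moreover have "(g \<circ> f) x = (g \<circ> f) x'" using assms unfolding reaches_def by simp
  ultimately show ?thesis using assms unfolding reaches_def by blast
qed

lemma trans_equiv_imp_trans_equiv_comp:
  "trans_equiv X f x x' \<Longrightarrow> trans_equiv X (g \<circ> f) x x'"
  unfolding trans_equiv_def using reaches_imp_reaches_comp by blast


section \<open>The decomposition of relative classes\<close>

theorem theorem2p7:
  fixes X :: "(int \<Rightarrow> 'a) set" and Y :: "(int \<Rightarrow> 'b) set" and Z :: "(int \<Rightarrow> 'c) set"
    and \<phi> :: "(int \<Rightarrow> 'a) \<Rightarrow> (int \<Rightarrow> 'b)"
    and \<psi> :: "(int \<Rightarrow> 'b) \<Rightarrow> (int \<Rightarrow> 'c)"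
    and \<pi> :: "(int \<Rightarrow> 'a) \<Rightarrow> (int \<Rightarrow> 'c)"
  assumes "shift_of_finite_type X" and "one_step X" and "irreducible_shift X"
    and "shift_of_finite_type Y" and "one_step Y" and "irreducible_shift Y"
    and "sofic Z"
    and "factor_code X Y \<phi>" and "one_block X \<phi>"
    and "factor_code Y Z \<psi>" and "one_block Y \<psi>"
    and "\<pi> = \<psi> \<circ> \<phi>"
  shows "(\<forall>x\<in>X. trans_class X \<phi> x \<subseteq> rel_class X Y \<phi> \<psi> x
                \<and> rel_class X Y \<phi> \<psi> x = trans_class X \<pi> x)
       \<and> (\<forall>C\<in>trans_classes X \<pi>. \<forall>u\<in>C. \<forall>v\<in>C.
             \<exists>D\<in>trans_classes Y \<psi>. \<phi> u \<in> D \<and> \<phi> v \<in> D)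
       \<and> (\<forall>x\<in>X.
             rel_class X Y \<phi> \<psi> x = \<Union> {trans_class X \<phi> x' |x'. rel_equiv X Y \<phi> \<psi> x' x}
           \<and> pairwise disjnt {trans_class X \<phi> x' |x'. rel_equiv X Y \<phi> \<psi> x' x})"
proof -
  have onto: "\<phi> ` X = Y" using assms(8) unfolding factor_code_def by blast
  then have into: "\<phi> ` X \<subseteq> Y" by simp
  have cw\<phi>: "coordinatewise X \<phi>"
    by (rule coordinatewise_one_block_factor_code[OF assms(8,9)])
  have cw\<psi>: "coordinatewise Y \<psi>"
    by (rule coordinatewise_one_block_factor_code[OF assms(10,11)])
  have cw\<pi>: "coordinatewise X \<pi>"
    unfolding assms(12) by (rule coordinatewise_comp[OF cw\<phi> cw\<psi> into])
  have rel_iff: "rel_equiv X Y \<phi> \<psi> x x' \<longleftrightarrow> trans_equiv X \<pi> x x'" for x x'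
    unfolding assms(12) by (rule rel_equiv_iff_trans_equiv_comp[OF cw\<phi> into])
  have finer: "trans_equiv X \<phi> x x' \<Longrightarrow> trans_equiv X \<pi> x x'" for x x'
    unfolding assms(12) by (rule trans_equiv_imp_trans_equiv_comp)
  have image: "trans_equiv X \<pi> x x' \<Longrightarrow> trans_equiv Y \<psi> (\<phi> x) (\<phi> x')" for x x'
    unfolding assms(12) by (rule trans_equiv_comp_imp_trans_equiv_image[OF cw\<phi> into])
  have rel_class: "rel_class X Y \<phi> \<psi> x = trans_class X \<pi> x" for x
    unfolding rel_class_def trans_class_def rel_iff ..
  have same_class: "\<exists>D\<in>trans_classes Y \<psi>. \<phi> u \<in> D \<and> \<phi> v \<in> D"
    if C: "C \<in> trans_classes X \<pi>" and uv: "u \<in> C" "v \<in> C" for C u v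
  proof -
    obtain x where x: "x \<in> X" and Cx: "C = trans_class X \<pi> x"
      using C unfolding trans_classes_def by blast
    have "trans_class Y \<psi> (\<phi> x) \<in> trans_classes Y \<psi>"
      using x into unfolding trans_classes_def by blast
    moreover have "\<phi> u \<in> trans_class Y \<psi> (\<phi> x)" "\<phi> v \<in> trans_class Y \<psi> (\<phi> x)"
      using uv image unfolding Cx trans_class_def by simp_all
    ultimately show ?thesis by blast
  qed
  have union: "trans_class X \<pi> x = \<Union> {trans_class X \<phi> x' |x'. trans_equiv X \<pi> x' x}" for x
  proof
    show "trans_class X \<pi> x \<subseteq> \<Union> {trans_class X \<phi> x' |x'. trans_equiv X \<pi> x' x}"
    proof
      fix z assume z: "z \<in> trans_class X \<pi> x"
      then have "z \<in> X" unfolding trans_class_def trans_equiv_def reaches_def by blast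
      then have "z \<in> trans_class X \<phi> z" unfolding trans_class_def by (simp add: trans_equiv_refl)
      then show "z \<in> \<Union> {trans_class X \<phi> x' |x'. trans_equiv X \<pi> x' x}"
        using z unfolding trans_class_def by blast
    qed
    show "\<Union> {trans_class X \<phi> x' |x'. trans_equiv X \<pi> x' x} \<subseteq> trans_class X \<pi> x"
    proof
      fix z assume "z \<in> \<Union> {trans_class X \<phi> x' |x'. trans_equiv X \<pi> x' x}"
      then obtain x' where "trans_equiv X \<phi> z x'" and x': "trans_equiv X \<pi> x' x"
        unfolding trans_class_def by blast
      then show "z \<in> trans_class X \<pi> x"
        using trans_equiv_trans[OF assms(1,2) cw\<pi> finer x'] unfolding trans_class_def by simp
    qed
  qed
  have subset: "trans_class X \<phi> x \<subseteq> trans_class X \<pi> x" for x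
    using finer unfolding trans_class_def by blast
  show ?thesis
    unfolding rel_class rel_iff
  proof (intro conjI ballI)
    fix x
    show "trans_class X \<phi> x \<subseteq> trans_class X \<pi> x" by (rule subset)
    show "trans_class X \<pi> x = trans_class X \<pi> x" ..
    show "trans_class X \<pi> x = \<Union> {trans_class X \<phi> x' |x'. trans_equiv X \<pi> x' x}"
      by (rule union)
    show "pairwise disjnt {trans_class X \<phi> x' |x'. trans_equiv X \<pi> x' x}"
      by (rule pairwise_disjnt_trans_classes[OF assms(1,2) cw\<phi>])
  next
    fix C u v assume "C \<in> trans_classes X \<pi>" "u \<in> C" "v \<in> C"
    then show "\<exists>D\<in>trans_classes Y \<psi>. \<phi> u \<in> D \<and> \<phi> v \<in> D" by (rule same_class)
  qed
qed

end
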